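(* Let $k$ be a field, $m\ge 1$ and $s\ge 2$ integers, $R=k[x_1,\dots,x_m]$, and let $I=I(K_m)\subset R$ be the edge ideal of the complete graph $K_m$ on $\{x_1,\dots,x_m\}$. Then the minimal monomial generating set of the $s$-th symbolic power $I^{(s)}$ is $$\mathcal G(I^{(s)})=\Big\{x_1^{a_1}\cdots x_m^{a_m} : a_1,\dots,a_m\in\mathbb Z_{\ge 0},\ \exists\, i\in\{1,\dots,m\}\text{ with }\sum_{j\ne i}a_j=s\text{ and }a_i=\max_{j\ne i}\{a_j\}\Big\}.$$
   Context: The edge ideal of a finite simple graph $G$ with vertex set $\{x_1,\dots,x_m\}$ is $I(G)=\langle x_ix_j:\{x_i,x_j\}\in E(G)\rangle$. $K_m$ is the complete graph on $m$ vertices. Symbolic powers: for a monomial ideal $I\subset R$ with primary decomposition $I=I_1\cap\dots\cap I_n$, and $Q$ an associated prime of $I$ maximal under inclusion, put $I_{\subseteq Q}=\bigcap_{\sqrt{I_\ell}\subseteq Q}I_\ell$; then $I^{(s)}=\bigcap_{Q}I_{\subseteq Q}^s$, the intersection running over all associated primes $Q$ of $I$ that are maximal with respect to inclusion. $\mathcal G(I)$ denotes the (unique) set of minimal monomial generators of a monomial ideal $I$, with $\mathcal G(0)=\emptyset$. (For $m=1$ the set on the right-hand side is empty, since the empty sum is $0\neq s$.) *)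

theory Defs
  imports
    "HOL-Algebra.Ideal_Product"
    "HOL-Algebra.Algebraic_Closure_Type"
    "HOL-Library.Poly_Mapping"
begin

section \<open>Primary decompositions and symbolic powers\<close>

definition ideal_radical :: "('a, 'b) ring_scheme \<Rightarrow> 'a set \<Rightarrow> 'a set" where
  "ideal_radical R I = {x \<in> carrier R. \<exists>n::nat. n > 0 \<and> x [^]\<^bsub>R\<^esub> n \<in> I}"

definition primary_ideal :: "'a set \<Rightarrow> ('a, 'b) ring_scheme \<Rightarrow> bool" where
  "primary_ideal I R \<longleftrightarrow> ideal I R \<and> I \<noteq> carrier R \<and>
     (\<forall>a \<in> carrier R. \<forall>b \<in> carrier R. a \<otimes>\<^bsub>R\<^esub> b \<in> I \<longrightarrow> a \<in> I \<or> b \<in> ideal_radical R I)"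

text \<open>An intersection of ideals is written with an explicit \<^term>\<open>carrier R\<close>, so that
  the empty intersection is the unit ideal.\<close>

definition primary_decomposition :: "('a, 'b) ring_scheme \<Rightarrow> 'a set \<Rightarrow> 'a set set \<Rightarrow> bool" where
  "primary_decomposition R I D \<longleftrightarrow>
     finite D \<and> (\<forall>J \<in> D. primary_ideal J R) \<and> carrier R \<inter> \<Inter>D = I"

definition associated_primes :: "('a, 'b) ring_scheme \<Rightarrow> 'a set \<Rightarrow> 'a set set" where
  "associated_primes R I =
     {P. primeideal P R \<and> (\<exists>f \<in> carrier R. P = {g \<in> carrier R. g \<otimes>\<^bsub>R\<^esub> f \<in> I})}"

definition maximal_associated_primes :: "('a, 'b) ring_scheme \<Rightarrow> 'a set \<Rightarrow> 'a set set" where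
  "maximal_associated_primes R I =
     {Q \<in> associated_primes R I. \<forall>P \<in> associated_primes R I. Q \<subseteq> P \<longrightarrow> P = Q}"

definition components_below :: "('a, 'b) ring_scheme \<Rightarrow> 'a set set \<Rightarrow> 'a set \<Rightarrow> 'a set" where
  "components_below R D Q = carrier R \<inter> \<Inter>{J \<in> D. ideal_radical R J \<subseteq> Q}"

text \<open>For a prime \<open>Q\<close> this ideal does not depend on the primary decomposition \<open>D\<close>: it is the
  contraction of the localisation of \<open>I\<close> at \<open>Q\<close>.\<close>

lemma (in cring) components_below_eq:
  assumes D: "primary_decomposition R I D" and Q: "primeideal Q R"
  shows "components_below R D Q = {f \<in> carrier R. \<exists>g \<in> carrier R - Q. f \<otimes> g \<in> I}"
proof -
  interpret Q: primeideal Q R by (rule Q)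
  have fin: "finite D" and prim: "\<And>J. J \<in> D \<Longrightarrow> primary_ideal J R"
    and I: "I = carrier R \<inter> \<Inter>D"
    using D by (auto simp: primary_decomposition_def)
  have idJ: "ideal J R" if "J \<in> D" for J
    using prim[OF that] by (simp add: primary_ideal_def)
  have avoid: "\<exists>g \<in> carrier R - Q. \<forall>J \<in> E. g \<in> J"
    if "finite E" "E \<subseteq> {J \<in> D. \<not> ideal_radical R J \<subseteq> Q}" for E
    using that
  proof (induction E rule: finite_induct)
    case empty
    show ?case using Q.I_notcarr Q.one_imp_carrier by auto
  next
    case (insert J E)
    then obtain g where g: "g \<in> carrier R" "g \<notin> Q" "\<forall>J \<in> E. g \<in> J" by auto
    from insert.prems obtain x where x: "x \<in> ideal_radical R J" "x \<notin> Q" and J: "J \<in> D" by auto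
    then obtain n :: nat where xn: "x \<in> carrier R" "x [^] n \<in> J"
      by (auto simp: ideal_radical_def)
    have "x [^] k \<notin> Q" for k :: nat
    proof (induction k)
      case 0
      show ?case using Q.I_notcarr Q.one_imp_carrier by auto
    next
      case (Suc k)
      then show ?case using Q.I_prime[of "x [^] k" x] xn x by auto
    qed
    then have "g \<otimes> x [^] n \<notin> Q" using Q.I_prime[of g "x [^] n"] g xn by auto
    moreover have "g \<otimes> x [^] n \<in> K" if "K \<in> insert J E" for K
    proof (cases "K = J")
      case True
      then show ?thesis using ideal.I_l_closed[OF idJ[OF J]] xn g by auto
    next
      case False
      then have "K \<in> E" using that by auto
      then have "K \<in> D" "g \<in> K" using insert.prems g by auto
      then show ?thesis using ideal.I_r_closed[OF idJ] xn by auto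
    qed
    ultimately show ?case using g xn by (intro bexI[of _ "g \<otimes> x [^] n"]) auto
  qed
  obtain g where g: "g \<in> carrier R" "g \<notin> Q"
      "\<forall>J \<in> {J \<in> D. \<not> ideal_radical R J \<subseteq> Q}. g \<in> J"
    using avoid[of "{J \<in> D. \<not> ideal_radical R J \<subseteq> Q}"] fin by auto
  show ?thesis
  proof (intro equalityI subsetI)
    fix f assume f: "f \<in> components_below R D Q"
    have "f \<otimes> g \<in> J" if "J \<in> D" for J
    proof (cases "ideal_radical R J \<subseteq> Q")
      case True
      then show ?thesis
        using f that g ideal.I_r_closed[OF idJ[OF that]] by (auto simp: components_below_def)
    next
      case False
      then show ?thesis
        using f that g ideal.I_l_closed[OF idJ[OF that]] by (auto simp: components_below_def)
    qed
    then show "f \<in> {f \<in> carrier R. \<exists>g \<in> carrier R - Q. f \<otimes> g \<in> I}"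
      using f g I by (auto simp: components_below_def)
  next
    fix f assume "f \<in> {f \<in> carrier R. \<exists>g \<in> carrier R - Q. f \<otimes> g \<in> I}"
    then obtain h where h: "f \<in> carrier R" "h \<in> carrier R" "h \<notin> Q" "f \<otimes> h \<in> I" by auto
    have "f \<in> J" if "J \<in> D" "ideal_radical R J \<subseteq> Q" for J
    proof -
      have "f \<otimes> h \<in> J" using h I that by auto
      then have "f \<in> J \<or> h \<in> ideal_radical R J"
        using prim[OF that(1)] h by (simp add: primary_ideal_def)
      then show ?thesis using that h by auto
    qed
    then show "f \<in> components_below R D Q"
      using h by (auto simp: components_below_def)
  qed
qed

text \<open>A primary decomposition exists in every Noetherian ring; by
  \<open>components_below_eq\<close> the result does not depend on which one is chosen.  The power of an
  ideal is its power in the library's semiring of ideals.\<close>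

definition symbolic_power :: "('a, 'b) ring_scheme \<Rightarrow> 'a set \<Rightarrow> nat \<Rightarrow> 'a set" where
  "symbolic_power R I s =
     (let D = (SOME D. primary_decomposition R I D)
      in carrier R \<inter>
         (\<Inter>Q \<in> maximal_associated_primes R I. components_below R D Q [^]\<^bsub>ideals_set R\<^esub> s))"


section \<open>Monomial ideals in a polynomial ring\<close>

text \<open>The variables are indexed by a finite type \<open>'n\<close>, so their number is \<open>CARD('n) \<ge> 1\<close>.
  An element maps exponent vectors to coefficients.\<close>

type_synonym ('n, 'k) mpoly = "('n \<Rightarrow>\<^sub>0 nat) \<Rightarrow>\<^sub>0 'k"

abbreviation mpoly_ring :: "('n, 'k::field) mpoly ring" where
  "mpoly_ring \<equiv> ring_of_type_algebra"

definition var :: "'n \<Rightarrow> ('n, 'k::field) mpoly" where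
  "var i = Poly_Mapping.single (Poly_Mapping.single i 1) 1"

definition monomial :: "('n::finite \<Rightarrow> nat) \<Rightarrow> ('n, 'k::field) mpoly" where
  "monomial a = (\<Prod>i\<in>UNIV. var i ^ a i)"

definition minimal_monomial_generating_set ::
    "('n::finite, 'k::field) mpoly set \<Rightarrow> ('n, 'k) mpoly set \<Rightarrow> bool" where
  "minimal_monomial_generating_set I G \<longleftrightarrow>
     G \<subseteq> range monomial \<and> Idl\<^bsub>mpoly_ring\<^esub> G = I \<and> (\<forall>H. H \<subset> G \<longrightarrow> Idl\<^bsub>mpoly_ring\<^esub> H \<noteq> I)"

definition minimal_monomial_generators ::
    "('n::finite, 'k::field) mpoly set \<Rightarrow> ('n, 'k) mpoly set" where
  "minimal_monomial_generators I = (THE G. minimal_monomial_generating_set I G)"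

text \<open>A simple graph on the vertex set \<open>UNIV :: 'n set\<close> is given by its set of edges, which are
  two-element sets of vertices.\<close>

definition edge_ideal :: "'n set set \<Rightarrow> ('n, 'k::field) mpoly set" where
  "edge_ideal E = Idl\<^bsub>mpoly_ring\<^esub> {var i * var j | i j. {i, j} \<in> E}"

definition complete_graph :: "'n set set" where
  "complete_graph = {{i, j} | i j. i \<noteq> j}"

end

theory Submission
  imports Defs
begin

text \<open>The ideal \<open>I(K\<^sub>m)\<close> is the intersection of the primes
  \<open>P\<^sub>i = \<langle>x\<^sub>j : j \<noteq> i\<rangle>\<close>: a monomial involves two different variables exactly
  if no single variable \<open>x\<^sub>i\<close> accounts for all of it, that is, if it lies in every \<open>P\<^sub>i\<close>.  No
  \<open>P\<^sub>i\<close> contains another one, so these primes are precisely the associated primes, all of them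
  are maximal, and localising at \<open>P\<^sub>i\<close> turns \<open>I\<close> into \<open>P\<^sub>i\<close>.  Hence the symbolic power is
  \<open>\<Inter>\<^sub>i P\<^sub>i\<^sup>s\<close> (\<open>symbolic_power_Inter_primes\<close>, which holds for any finite antichain of primes in a
  commutative ring).

  The power \<open>P\<^sub>i\<^sup>s\<close> is spanned by the monomials \<open>x\<^sup>a\<close> whose degree in the variables other than
  \<open>x\<^sub>i\<close>, here called \<open>off_degree i a\<close>, is at least \<open>s\<close> (\<open>cover_prime_power\<close>).  So \<open>I\<^sup>(\<^sup>s\<^sup>)\<close> is
  the monomial ideal whose exponents satisfy \<open>s \<le> off_degree i a\<close> for all \<open>i\<close>, and the minimal
  generators of a monomial ideal are the monomials with componentwise minimal exponent
  (\<open>minimal_monomial_generators_monomial_span\<close>).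

  It remains to find these minimal exponents.  Since \<open>off_degree i a + a i\<close> is the total degree, the
  binding condition belongs to the largest entry.  If the maximum is attained at one index \<open>i\<close> only,
  lowering \<open>a i\<close> by one violates no condition; so a minimal exponent attains its maximum
  twice, and lowering one maximal entry can only fail because \<open>off_degree\<close> equals \<open>s\<close> at
  another one.  Conversely, if two indices both have \<open>off_degree\<close> equal to \<open>s\<close>, lowering any
  entry pushes at least one of the two below \<open>s\<close> (\<open>minimal_elements_symbolic_power\<close>).\<close>

section \<open>Symbolic powers of a finite intersection of primes\<close>

text \<open>The product of one element from each \<open>J - Q\<close> lies in every \<open>J\<close>, and it is not in the prime
  \<open>Q\<close>.  For an empty family the witness is \<open>\<one>\<close>.\<close>

lemma (in cring) prime_avoids_Inter:
  assumes Q: "primeideal Q R" and "finite A" "\<And>J. J \<in> A \<Longrightarrow> ideal J R \<and> \<not> J \<subseteq> Q"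
  shows "\<exists>g \<in> carrier R - Q. g \<in> \<Inter>A"
  using assms(2,3)
proof (induction A rule: finite_induct)
  case empty
  interpret Q: primeideal Q R by (rule Q)
  show ?case using Q.I_notcarr Q.one_imp_carrier by auto
next
  case (insert J A)
  interpret Q: primeideal Q R by (rule Q)
  obtain g where g: "g \<in> carrier R" "g \<notin> Q" "g \<in> \<Inter>A" using insert by auto
  have J: "ideal J R" and "\<not> J \<subseteq> Q" using insert.prems by auto
  then obtain x where x: "x \<in> J" "x \<notin> Q" by auto
  have xc: "x \<in> carrier R" using ideal.Icarr[OF J x(1)] .
  have "g \<otimes> x \<notin> Q" using Q.I_prime g x xc by blast
  moreover have "g \<otimes> x \<in> K" if "K \<in> insert J A" for K
    using that insert.prems ideal.I_l_closed[OF J x(1) g(1)] g(3) ideal.I_r_closed[of K R g x] xc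
    by auto
  ultimately show ?case using g xc by (intro bexI[of _ "g \<otimes> x"]) auto
qed

context cring
begin

context
  fixes \<P> :: "'a set set" and I :: "'a set"
  assumes finite_primes: "finite \<P>"
    and primes: "\<And>P. P \<in> \<P> \<Longrightarrow> primeideal P R"
    and antichain: "\<And>P Q. P \<in> \<P> \<Longrightarrow> Q \<in> \<P> \<Longrightarrow> P \<subseteq> Q \<Longrightarrow> P = Q"
    and I_def: "I = carrier R \<inter> \<Inter>\<P>"
begin

lemma primary_decomposition_primes: "primary_decomposition R I \<P>"
proof -
  have "primary_ideal P R" if "P \<in> \<P>" for P
  proof -
    interpret P: primeideal P R by (rule primes[OF that])
    have "b \<in> ideal_radical R P" if "b \<in> P" for b
      using that P.Icarr by (auto simp: ideal_radical_def intro!: exI[of _ "1::nat"])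
    then show ?thesis
      using P.is_ideal P.I_notcarr P.I_prime unfolding primary_ideal_def by blast
  qed
  then show ?thesis using finite_primes I_def by (simp add: primary_decomposition_def)
qed

text \<open>Such an element witnesses both that \<open>P\<close> is associated to \<open>I\<close> and that \<open>I\<close> becomes \<open>P\<close> on
  localising at \<open>P\<close>.\<close>

lemma separating_element:
  assumes "P \<in> \<P>"
  obtains h where "h \<in> carrier R" "h \<notin> P" "\<And>Q. Q \<in> \<P> \<Longrightarrow> Q \<noteq> P \<Longrightarrow> h \<in> Q"
proof -
  have "\<exists>h \<in> carrier R - P. h \<in> \<Inter>(\<P> - {P})"
  proof (rule prime_avoids_Inter)
    show "ideal J R \<and> \<not> J \<subseteq> P" if "J \<in> \<P> - {P}" for J
      using that assms antichain primes[of J] by (auto simp: primeideal_def)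
  qed (use finite_primes primes assms in auto)
  then show ?thesis using that by auto
qed

lemma mult_separating_element_in_Inter:
  assumes "P \<in> \<P>" "h \<in> carrier R" "\<And>Q. Q \<in> \<P> \<Longrightarrow> Q \<noteq> P \<Longrightarrow> h \<in> Q" "f \<in> P"
  shows "f \<otimes> h \<in> I"
proof -
  interpret P: primeideal P R by (rule primes[OF assms(1)])
  have f: "f \<in> carrier R" using assms(4) by (rule P.Icarr)
  have "f \<otimes> h \<in> Q" if "Q \<in> \<P>" for Q
  proof -
    interpret Q: primeideal Q R by (rule primes[OF that])
    show ?thesis
    proof (cases "Q = P")
      case True
      then show ?thesis using Q.I_r_closed assms(2,4) by simp
    next
      case False
      then show ?thesis using Q.I_l_closed assms(3)[OF that] f by simp
    qed
  qed
  then show ?thesis using f assms(2) I_def by auto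
qed

text \<open>The ideal quotient \<open>I : f\<close> is the intersection of those members of \<open>\<P>\<close> that do not contain
  \<open>f\<close>.  If it is a prime \<open>P\<close>, it contains one of them by avoidance, and then equals it.  Conversely
  \<open>P = I : h\<close> for an element \<open>h\<close> that separates \<open>P\<close> from the rest.\<close>

lemma associated_primes_Inter: "associated_primes R I = \<P>"
proof (intro equalityI subsetI)
  fix P assume "P \<in> associated_primes R I"
  then obtain f where P: "primeideal P R" and f: "f \<in> carrier R"
    and Peq: "P = {g \<in> carrier R. g \<otimes> f \<in> I}"
    by (auto simp: associated_primes_def)
  have "\<exists>J \<in> {J \<in> \<P>. f \<notin> J}. J \<subseteq> P"
  proof (rule ccontr)
    assume *: "\<not> ?thesis"
    have "\<exists>g \<in> carrier R - P. g \<in> \<Inter>{J \<in> \<P>. f \<notin> J}"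
    proof (rule prime_avoids_Inter[OF P])
      show "ideal J R \<and> \<not> J \<subseteq> P" if "J \<in> {J \<in> \<P>. f \<notin> J}" for J
        using that * primes[of J] by (auto simp: primeideal_def)
    qed (use finite_primes in auto)
    then obtain g where g: "g \<in> carrier R" "g \<notin> P" "\<And>J. J \<in> \<P> \<Longrightarrow> f \<notin> J \<Longrightarrow> g \<in> J" by auto
    have "g \<otimes> f \<in> J" if "J \<in> \<P>" for J
    proof -
      interpret J: primeideal J R by (rule primes[OF that])
      show ?thesis
        using g(1) g(3)[OF that] f J.I_l_closed[of f g] J.I_r_closed[of g f] by blast
    qed
    then have "g \<in> P" using g f by (simp add: Peq I_def)
    with g show False by simp
  qed
  then obtain J where J: "J \<in> \<P>" "f \<notin> J" "J \<subseteq> P" by auto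
  interpret J: primeideal J R by (rule primes[OF J(1)])
  have "P \<subseteq> J"
  proof
    fix g assume "g \<in> P"
    then have "g \<in> carrier R" "g \<otimes> f \<in> J" using J(1) by (auto simp: Peq I_def)
    then show "g \<in> J" using J.I_prime f J(2) by blast
  qed
  with J show "P \<in> \<P>" by auto
next
  fix P assume P: "P \<in> \<P>"
  interpret P: primeideal P R by (rule primes[OF P])
  obtain h where h: "h \<in> carrier R" "h \<notin> P" "\<And>Q. Q \<in> \<P> \<Longrightarrow> Q \<noteq> P \<Longrightarrow> h \<in> Q"
    using separating_element[OF P] by blast
  have "P = {g \<in> carrier R. g \<otimes> h \<in> I}"
  proof (intro equalityI subsetI)
    fix g assume "g \<in> {g \<in> carrier R. g \<otimes> h \<in> I}"
    then have "g \<in> carrier R" "g \<otimes> h \<in> P" using P I_def by auto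
    then show "g \<in> P" using P.I_prime h(1,2) by blast
  next
    fix g assume "g \<in> P"
    then show "g \<in> {g \<in> carrier R. g \<otimes> h \<in> I}"
      using mult_separating_element_in_Inter[OF P h(1,3)] P.Icarr by simp
  qed
  then show "P \<in> associated_primes R I"
    unfolding associated_primes_def mem_Collect_eq using P.primeideal h(1) by (intro conjI bexI[of _ h])
qed

text \<open>The chosen decomposition \<open>D\<close> need not be \<open>\<P>\<close> itself, so the component is computed through
  its description as a contraction from the localisation at \<open>P\<close>.\<close>

lemma components_below_prime:
  assumes "P \<in> \<P>" "primary_decomposition R I D"
  shows "components_below R D P = P"
proof -
  interpret P: primeideal P R by (rule primes[OF assms(1)])
  obtain h where h: "h \<in> carrier R" "h \<notin> P" "\<And>Q. Q \<in> \<P> \<Longrightarrow> Q \<noteq> P \<Longrightarrow> h \<in> Q"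
    using separating_element[OF assms(1)] by blast
  have "P = {f \<in> carrier R. \<exists>g \<in> carrier R - P. f \<otimes> g \<in> I}"
  proof (intro equalityI subsetI)
    fix f assume "f \<in> {f \<in> carrier R. \<exists>g \<in> carrier R - P. f \<otimes> g \<in> I}"
    then obtain g where "f \<in> carrier R" "g \<in> carrier R" "g \<notin> P" "f \<otimes> g \<in> P"
      using assms(1) I_def by auto
    then show "f \<in> P" using P.I_prime by blast
  next
    fix f assume "f \<in> P"
    then have "f \<in> carrier R" "f \<otimes> h \<in> I"
      using mult_separating_element_in_Inter[OF assms(1) h(1,3)] P.Icarr by simp_all
    then show "f \<in> {f \<in> carrier R. \<exists>g \<in> carrier R - P. f \<otimes> g \<in> I}"
      using h(1,2) by blast
  qed
  then show ?thesis using components_below_eq[OF assms(2) P.primeideal] by simp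
qed

lemma symbolic_power_Inter_primes:
  "symbolic_power R I s = carrier R \<inter> (\<Inter>P\<in>\<P>. P [^]\<^bsub>ideals_set R\<^esub> s)"
proof -
  define D where "D = (SOME D. primary_decomposition R I D)"
  have D: "primary_decomposition R I D"
    unfolding D_def using primary_decomposition_primes by (rule someI)
  have "maximal_associated_primes R I = \<P>"
    using antichain by (auto simp: maximal_associated_primes_def associated_primes_Inter)
  then show ?thesis
    using components_below_prime[OF _ D] by (simp add: symbolic_power_def D_def[symmetric])
qed

end

end

section \<open>Monomial ideals and their sets of exponents\<close>

lemma mpoly_ring_simps [simp]:
  "carrier mpoly_ring = UNIV" "(\<otimes>\<^bsub>mpoly_ring\<^esub>) = (*)" "(\<oplus>\<^bsub>mpoly_ring\<^esub>) = (+)"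
  "\<one>\<^bsub>mpoly_ring\<^esub> = 1" "\<zero>\<^bsub>mpoly_ring\<^esub> = 0"
  by (simp_all add: ring_of_type_algebra_def)

lemma cring_mpoly_ring: "cring (mpoly_ring :: ('n, 'k::field) mpoly ring)"
  by (rule cring_from_type_algebra)

lemmas ring_mpoly_ring = cring.axioms(1)[OF cring_mpoly_ring]

text \<open>For an upward closed set \<open>A\<close> of exponents this is the monomial ideal with exponent set \<open>A\<close>.
  Reading membership off the support reduces ideal operations to operations on sets of
  exponents.\<close>

definition monomial_span :: "('n::finite \<Rightarrow> nat) set \<Rightarrow> ('n, 'k::field) mpoly set" where
  "monomial_span A = {f. \<forall>t \<in> Poly_Mapping.keys f. Poly_Mapping.lookup t \<in> A}"

definition up_closed :: "('n \<Rightarrow> nat) set \<Rightarrow> bool" where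
  "up_closed A \<longleftrightarrow> (\<forall>a \<in> A. \<forall>b. a \<le> b \<longrightarrow> b \<in> A)"

lemma poly_mapping_sum_singles:
  "f = (\<Sum>t\<in>Poly_Mapping.keys f. Poly_Mapping.single t (Poly_Mapping.lookup f t))"
proof (rule poly_mapping_eqI)
  fix t
  show "Poly_Mapping.lookup f t =
      Poly_Mapping.lookup (\<Sum>t\<in>Poly_Mapping.keys f. Poly_Mapping.single t (Poly_Mapping.lookup f t)) t"
    by (simp add: lookup_sum lookup_single when_def in_keys_iff)
qed

lemma lookup_Abs_finite [simp]:
  "Poly_Mapping.lookup (Abs_poly_mapping (a :: 'n::finite \<Rightarrow> nat)) = a"
  by simp

lemma single_power:
  "Poly_Mapping.single (Poly_Mapping.single i (1::nat)) (1::'k::comm_semiring_1) ^ n =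
   Poly_Mapping.single (Poly_Mapping.single i n) 1"
  by (induction n) (simp_all add: mult_single single_add[symmetric])

lemma prod_single:
  "(\<Prod>i\<in>A. Poly_Mapping.single (t i :: 't::comm_monoid_add) (1::'k::comm_semiring_1)) =
   Poly_Mapping.single (\<Sum>i\<in>A. t i) 1"
  by (induction A rule: infinite_finite_induct) (simp_all add: mult_single)

lemma monomial_eq_single:
  "(monomial a :: ('n::finite, 'k::field) mpoly) = Poly_Mapping.single (Abs_poly_mapping a) 1"
proof -
  have "(\<Sum>i\<in>UNIV. Poly_Mapping.single i (a i)) = Abs_poly_mapping a"
    by (rule poly_mapping_eqI) (simp add: lookup_sum lookup_single when_def)
  then show ?thesis by (simp add: monomial_def var_def single_power[unfolded One_nat_def] prod_single)
qed

lemma monomial_lookup: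
  "(monomial (Poly_Mapping.lookup t) :: ('n::finite, 'k::field) mpoly) = Poly_Mapping.single t 1"
  by (simp add: monomial_eq_single)

lemma monomial_in_span_iff [simp]: "monomial a \<in> monomial_span A \<longleftrightarrow> a \<in> A"
  by (simp add: monomial_span_def monomial_eq_single)

lemma monomial_mult: "monomial a * monomial b = monomial (\<lambda>i. a i + b i)"
  by (simp add: monomial_def power_add prod.distrib)

lemma monomial_span_eq_iff:
  "(monomial_span A :: ('n::finite, 'k::field) mpoly set) = monomial_span B \<longleftrightarrow> A = B"
proof
  assume *: "(monomial_span A :: ('n, 'k) mpoly set) = monomial_span B"
  have "a \<in> A \<longleftrightarrow> a \<in> B" for a
    by (metis * monomial_in_span_iff)
  then show "A = B" by auto
qed simp

lemma monomial_span_INT: "(\<Inter>i. monomial_span (A i)) = monomial_span (\<Inter>i. A i)"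
  by (auto simp: monomial_span_def)

lemma monomial_span_closed:
  shows monomial_span_zero: "0 \<in> monomial_span A"
    and monomial_span_add: "f \<in> monomial_span A \<Longrightarrow> g \<in> monomial_span A \<Longrightarrow> f + g \<in> monomial_span A"
    and monomial_span_uminus: "f \<in> monomial_span A \<Longrightarrow> - f \<in> monomial_span A"
  using keys_add[of f g] by (auto simp: monomial_span_def in_keys_iff)

lemma monomial_span_mult:
  assumes "f \<in> monomial_span A" "g \<in> monomial_span B"
    and "\<And>a b. a \<in> A \<Longrightarrow> b \<in> B \<Longrightarrow> (\<lambda>i. a i + b i) \<in> C"
  shows "f * g \<in> monomial_span C"
  using assms keys_mult[of f g] by (fastforce simp: monomial_span_def plus_poly_mapping.rep_eq)

lemma monomial_span_UNIV [simp]: "monomial_span UNIV = UNIV"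
  by (auto simp: monomial_span_def)

lemma ideal_monomial_span:
  assumes "up_closed A"
  shows "ideal (monomial_span A :: ('n::finite, 'k::field) mpoly set) mpoly_ring"
proof -
  interpret cring "mpoly_ring :: ('n, 'k) mpoly ring" by (rule cring_mpoly_ring)
  have inv: "inv\<^bsub>add_monoid mpoly_ring\<^esub> f = - f" for f :: "('n, 'k) mpoly"
    using minus_equality[of "- f" f] by (simp add: a_inv_def)
  have l: "g * f \<in> monomial_span A" if "f \<in> monomial_span A" for f g :: "('n, 'k) mpoly"
  proof (rule monomial_span_mult[of g UNIV f A])
    show "(\<lambda>i. a i + b i) \<in> A" if "b \<in> A" for a b
    proof -
      have "b \<le> (\<lambda>i. a i + b i)" by (simp add: le_fun_def)
      then show ?thesis using that assms unfolding up_closed_def by blast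
    qed
  qed (use that in auto)
  show ?thesis
  proof (rule idealI)
    show "subgroup (monomial_span A) (add_monoid (mpoly_ring :: ('n, 'k) mpoly ring))"
      by (rule group.subgroupI[OF a_group])
         (use inv monomial_span_zero in \<open>auto intro: monomial_span_add monomial_span_uminus\<close>)
  qed (use l ring_axioms in \<open>auto simp: mult.commute\<close>)
qed

text \<open>Stated for a set \<open>J\<close> that is only assumed to be closed under addition and to contain all scalar
  multiples of the monomials, so that it applies to a product of two spans,
  which need not be an ideal.\<close>

lemma monomial_span_subset_closed:
  fixes J :: "('n::finite, 'k::field) mpoly set"
  assumes "0 \<in> J" "\<And>f g. f \<in> J \<Longrightarrow> g \<in> J \<Longrightarrow> f + g \<in> J"
    and "\<And>a c. a \<in> A \<Longrightarrow> Poly_Mapping.single 0 c * monomial a \<in> J"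
  shows "monomial_span A \<subseteq> J"
proof
  fix f :: "('n, 'k) mpoly" assume f: "f \<in> monomial_span A"
  have "(\<Sum>t\<in>T. Poly_Mapping.single t (Poly_Mapping.lookup f t)) \<in> J"
    if "finite T" "T \<subseteq> Poly_Mapping.keys f" for T
    using that
  proof (induction T rule: finite_induct)
    case (insert t T)
    have "Poly_Mapping.single t (Poly_Mapping.lookup f t) =
        Poly_Mapping.single 0 (Poly_Mapping.lookup f t) * monomial (Poly_Mapping.lookup t)"
      by (simp add: monomial_lookup mult_single)
    then have "Poly_Mapping.single t (Poly_Mapping.lookup f t) \<in> J"
      using assms(3)[of "Poly_Mapping.lookup t"] f insert.prems by (auto simp: monomial_span_def)
    then show ?case using insert by (auto intro: assms(2))
  qed (use assms(1) in simp)
  from this[of "Poly_Mapping.keys f"] show "f \<in> J"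
    using poly_mapping_sum_singles[of f] by simp
qed

lemma monomial_span_subset_ideal:
  fixes J :: "('n::finite, 'k::field) mpoly set"
  assumes "ideal J mpoly_ring" "monomial ` A \<subseteq> J"
  shows "monomial_span A \<subseteq> J"
proof -
  interpret J: ideal J "mpoly_ring :: ('n, 'k) mpoly ring" by (rule assms(1))
  note sub = ideal.axioms(1)[OF assms(1)]
  show ?thesis
  proof (rule monomial_span_subset_closed)
    show "0 \<in> J" using additive_subgroup.zero_closed[OF sub] by simp
    show "f + g \<in> J" if "f \<in> J" "g \<in> J" for f g using additive_subgroup.a_closed[OF sub that] by simp
    show "Poly_Mapping.single 0 c * monomial a \<in> J" if "a \<in> A" for a c
      using J.I_l_closed[of "monomial a"] assms(2) that by auto
  qed
qed

definition up_closure :: "('n \<Rightarrow> nat) set \<Rightarrow> ('n \<Rightarrow> nat) set" where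
  "up_closure B = {c. \<exists>b \<in> B. b \<le> c}"

lemma up_closed_up_closure: "up_closed (up_closure B)"
  unfolding up_closed_def up_closure_def using order_trans by blast

lemma genideal_monomials:
  "Idl\<^bsub>mpoly_ring\<^esub> (monomial ` B) = (monomial_span (up_closure B) :: ('n::finite, 'k::field) mpoly set)"
proof -
  interpret ring "mpoly_ring :: ('n, 'k) mpoly ring" by (rule ring_mpoly_ring)
  let ?J = "Idl\<^bsub>mpoly_ring\<^esub> (monomial ` B :: ('n, 'k) mpoly set)"
  have J: "ideal ?J mpoly_ring" by (rule genideal_ideal) simp
  have gen: "monomial b \<in> ?J" if "b \<in> B" for b
    using genideal_self[of "monomial ` B"] that by auto
  have "monomial c \<in> ?J" if c: "c \<in> up_closure B" for c
  proof -
    obtain b where b: "b \<in> B" "b \<le> c" using c by (auto simp: up_closure_def)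
    have "monomial (\<lambda>i. c i - b i) * monomial b \<in> ?J"
      using ideal.I_l_closed[OF J gen[OF b(1)]] by simp
    moreover have "(\<lambda>i. c i - b i + b i) = c" using b(2) by (auto simp: le_fun_def)
    ultimately show ?thesis by (simp add: monomial_mult)
  qed
  then have "monomial_span (up_closure B) \<subseteq> ?J"
    by (intro monomial_span_subset_ideal[OF J]) auto
  moreover have "?J \<subseteq> monomial_span (up_closure B)"
    by (rule genideal_minimal[OF ideal_monomial_span[OF up_closed_up_closure]])
       (auto simp: up_closure_def)
  ultimately show ?thesis by auto
qed

text \<open>The factors are arbitrary linear spans of monomials.  A scalar is absorbed into the first
  factor, which makes the product closed under scalars.\<close>

lemma ideal_prod_monomial_span:
  "ideal_prod mpoly_ring (monomial_span A) (monomial_span B) =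
   (monomial_span {c. \<exists>a\<in>A. \<exists>b\<in>B. c = (\<lambda>i. a i + b i)} :: ('n::finite, 'k::field) mpoly set)"
    (is "?P = monomial_span ?C")
proof
  show "?P \<subseteq> monomial_span ?C"
  proof
    fix f assume "f \<in> ?P"
    then show "f \<in> monomial_span ?C"
    proof (induction rule: ideal_prod.induct)
      case (prod f g)
      then show ?case using monomial_span_mult[of f A g B ?C] by auto
    qed (simp add: monomial_span_add)
  qed
  have scaled: "Poly_Mapping.single 0 c * monomial a \<in> monomial_span A"
    if "a \<in> A" for a :: "'n \<Rightarrow> nat" and A and c :: 'k
    using that by (simp add: monomial_eq_single mult_single monomial_span_def)
  show "monomial_span ?C \<subseteq> ?P"
  proof (rule monomial_span_subset_closed)
    show "0 \<in> ?P"
      using ideal_prod.prod[OF monomial_span_zero monomial_span_zero, of mpoly_ring A B] by simp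
    show "f + g \<in> ?P" if "f \<in> ?P" "g \<in> ?P" for f g
      using ideal_prod.sum[OF that] by simp
    show "Poly_Mapping.single 0 c * monomial d \<in> ?P" if d: "d \<in> ?C" for c :: 'k and d
    proof -
      obtain a b where ab: "a \<in> A" "b \<in> B" "d = (\<lambda>i. a i + b i)" using d by auto
      have "(Poly_Mapping.single 0 c * monomial a) * monomial b \<in> ?P"
        using ideal_prod.prod[of "Poly_Mapping.single 0 c * monomial a" "monomial_span A"
            "monomial b" "monomial_span B" "mpoly_ring :: ('n, 'k) mpoly ring"] scaled ab by simp
      then show ?thesis by (simp add: ab(3) monomial_mult[symmetric] mult.assoc)
    qed
  qed
qed

definition minimal_elements :: "('n \<Rightarrow> nat) set \<Rightarrow> ('n \<Rightarrow> nat) set" where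
  "minimal_elements A = {a \<in> A. \<forall>b \<in> A. b \<le> a \<longrightarrow> b = a}"

text \<open>Below every element of \<open>A\<close> lies a minimal one, because stepping down strictly decreases the
  total degree.\<close>

lemma up_closure_minimal_elements:
  fixes A :: "('n::finite \<Rightarrow> nat) set"
  assumes "up_closed A"
  shows "up_closure (minimal_elements A) = A"
proof
  show "up_closure (minimal_elements A) \<subseteq> A"
    using assms unfolding up_closed_def up_closure_def minimal_elements_def by auto
  show "A \<subseteq> up_closure (minimal_elements A)"
  proof
    fix a assume "a \<in> A"
    then show "a \<in> up_closure (minimal_elements A)"
    proof (induction "\<Sum>i\<in>UNIV. a i" arbitrary: a rule: less_induct)
      case less
      show ?case
      proof (cases "a \<in> minimal_elements A")
        case True
        then show ?thesis by (auto simp: up_closure_def)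
      next
        case False
        then obtain b where b: "b \<in> A" "b \<le> a" "b \<noteq> a"
          using less.prems by (auto simp: minimal_elements_def)
        then obtain i where "b i \<noteq> a i" by auto
        with b have "b i < a i" by (metis le_fun_def order_le_less)
        then have "(\<Sum>i\<in>UNIV. b i) < (\<Sum>i\<in>UNIV. a i)"
          using b(2) by (intro sum_strict_mono_ex1) (auto simp: le_fun_def)
        from less.hyps[OF this b(1)] show ?thesis
          using b(2) up_closed_up_closure unfolding up_closed_def by blast
      qed
    qed
  qed
qed

lemma minimal_elements_subset_generators:
  assumes "up_closure B = A"
  shows "minimal_elements A \<subseteq> B"
proof
  fix a assume a: "a \<in> minimal_elements A"
  then obtain b where b: "b \<in> B" "b \<le> a"
    using assms by (auto simp: minimal_elements_def up_closure_def)
  have "b \<in> A" using assms b(1) by (auto simp: up_closure_def)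
  with a b show "a \<in> B" by (auto simp: minimal_elements_def)
qed

text \<open>Monomials with exponents \<open>B\<close> generate the ideal exactly if \<open>up_closure B = A\<close>.  Each such \<open>B\<close>
  contains the minimal elements of \<open>A\<close>, and these alone suffice; so they form the
  least set of monomial generators, which is therefore also the only irredundant one.\<close>

lemma minimal_monomial_generators_monomial_span:
  fixes A :: "('n::finite \<Rightarrow> nat) set"
  assumes A: "up_closed A"
  shows "minimal_monomial_generators (monomial_span A :: ('n, 'k::field) mpoly set) =
         monomial ` minimal_elements A"
  unfolding minimal_monomial_generators_def
proof (rule the_equality)
  let ?G = "monomial ` minimal_elements A :: ('n, 'k) mpoly set"
  have gen: "Idl\<^bsub>mpoly_ring\<^esub> ?G = monomial_span A"
    by (simp add: genideal_monomials up_closure_minimal_elements[OF A])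
  have least: "?G \<subseteq> H"
    if H: "H \<subseteq> range monomial" and "Idl\<^bsub>mpoly_ring\<^esub> H = monomial_span A" for H
  proof -
    obtain B where B: "H = monomial ` B" using H by (metis subset_imageE)
    have "up_closure B = A"
      using that(2) by (simp add: B genideal_monomials monomial_span_eq_iff)
    from minimal_elements_subset_generators[OF this] show ?thesis by (auto simp: B)
  qed
  show "minimal_monomial_generating_set (monomial_span A) ?G"
    unfolding minimal_monomial_generating_set_def
  proof (intro conjI allI impI notI)
    fix H assume "H \<subset> ?G" "Idl\<^bsub>mpoly_ring\<^esub> H = monomial_span A"
    then show False using least[of H] by blast
  qed (use gen in auto)
  fix G :: "('n, 'k) mpoly set"
  assume "minimal_monomial_generating_set (monomial_span A) G"
  then show "G = ?G"
    using least[of G] gen unfolding minimal_monomial_generating_set_def by (metis psubsetI)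
qed

section \<open>The minimal primes of the edge ideal of a complete graph\<close>

definition off_degree :: "'n::finite \<Rightarrow> ('n \<Rightarrow> nat) \<Rightarrow> nat" where
  "off_degree i a = (\<Sum>j\<in>UNIV - {i}. a j)"

text \<open>This is \<open>\<langle>x\<^sub>j : j \<noteq> i\<rangle>\<close>, named after the minimal vertex cover \<open>UNIV - {i}\<close> of the complete
  graph.  With a single variable it is the zero ideal.\<close>

definition cover_prime :: "'n::finite \<Rightarrow> ('n, 'k::field) mpoly set" where
  "cover_prime i = monomial_span {a. 1 \<le> off_degree i a}"

lemma off_degree_add: "off_degree i (\<lambda>j. a j + b j) = off_degree i a + off_degree i b"
  by (simp add: off_degree_def sum.distrib)

lemma off_degree_mono: "a \<le> b \<Longrightarrow> off_degree i a \<le> off_degree i b"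
  unfolding off_degree_def by (intro sum_mono) (simp add: le_fun_def)

lemma up_closed_off_degree: "up_closed {a. s \<le> off_degree i a}"
  using off_degree_mono order_trans unfolding up_closed_def by blast

lemma off_degree_pos_iff: "0 < off_degree i a \<longleftrightarrow> (\<exists>j. j \<noteq> i \<and> 0 < a j)"
  by (auto simp: off_degree_def neq0_conv[symmetric] simp del: neq0_conv)

lemma off_degree_unit: "off_degree i (\<lambda>k. if k = j then 1 else 0) = (if j = i then 0 else 1)"
  by (auto simp: off_degree_def)

lemma map_key_sum:
  assumes "inj h"
  shows "Poly_Mapping.map_key h (\<Sum>x\<in>S. f x) = (\<Sum>x\<in>S. Poly_Mapping.map_key h (f x))"
  by (induction S rule: infinite_finite_induct)
     (simp_all add: map_key_plus[OF assms] map_key_zero[OF assms])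

lemma map_key_single_notin:
  assumes "inj h" "t \<notin> range h"
  shows "Poly_Mapping.map_key h (Poly_Mapping.single t c) = 0"
  using assms by (intro poly_mapping_eqI) (auto simp: map_key.rep_eq lookup_single when_def)

text \<open>Restricting a polynomial to the exponents \<open>single i n\<close> sets all variables other than \<open>x\<^sub>i\<close> to
  zero.  It is multiplicative because a sum of two exponents lies on the \<open>i\<close>-th axis
  only if both summands do.\<close>

lemma map_key_single_mult:
  fixes f g :: "('n, 'k::field) mpoly"
  shows "Poly_Mapping.map_key (Poly_Mapping.single i) (f * g) =
    Poly_Mapping.map_key (Poly_Mapping.single i) f * Poly_Mapping.map_key (Poly_Mapping.single i) g"
proof -
  let ?\<phi> = "Poly_Mapping.map_key (Poly_Mapping.single i) :: ('n, 'k) mpoly \<Rightarrow> nat \<Rightarrow>\<^sub>0 'k"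
  have singles: "?\<phi> (Poly_Mapping.single s c * Poly_Mapping.single t d) =
      ?\<phi> (Poly_Mapping.single s c) * ?\<phi> (Poly_Mapping.single t d)" for s t c d
  proof (cases "s \<in> range (Poly_Mapping.single i) \<and> t \<in> range (Poly_Mapping.single i)")
    case True
    then obtain m n where "s = Poly_Mapping.single i m" "t = Poly_Mapping.single i n" by auto
    then show ?thesis
      by (simp add: mult_single single_add[symmetric] map_key_single[OF inj_single])
  next
    case False
    have axis: "u \<in> range (Poly_Mapping.single i) \<longleftrightarrow> (\<forall>j. j \<noteq> i \<longrightarrow> Poly_Mapping.lookup u j = 0)"
      for u :: "'n \<Rightarrow>\<^sub>0 nat"
    proof
      assume "\<forall>j. j \<noteq> i \<longrightarrow> Poly_Mapping.lookup u j = 0"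
      then have "u = Poly_Mapping.single i (Poly_Mapping.lookup u i)"
        by (intro poly_mapping_eqI) (auto simp: lookup_single when_def)
      then show "u \<in> range (Poly_Mapping.single i)" by blast
    qed (auto simp: lookup_single)
    from False have "s + t \<notin> range (Poly_Mapping.single i)"
      by (auto simp: axis lookup_add)
    with False show ?thesis
      by (auto simp: mult_single map_key_single_notin[OF inj_single])
  qed
  show ?thesis
    by (subst (1 2) poly_mapping_sum_singles, subst (3) poly_mapping_sum_singles,
        subst (4) poly_mapping_sum_singles)
       (simp only: sum_product map_key_sum[OF inj_single] singles)
qed

lemma cover_prime_eq_kernel:
  "cover_prime i = {f :: ('n::finite, 'k::field) mpoly. Poly_Mapping.map_key (Poly_Mapping.single i) f = 0}"
proof -
  have "f \<in> cover_prime i \<longleftrightarrow> (\<forall>n. Poly_Mapping.lookup f (Poly_Mapping.single i n) = 0)"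
    for f :: "('n, 'k) mpoly"
  proof
    assume f: "f \<in> cover_prime i"
    have "Poly_Mapping.single i n \<notin> Poly_Mapping.keys f" for n
    proof
      assume "Poly_Mapping.single i n \<in> Poly_Mapping.keys f"
      then have "0 < off_degree i (Poly_Mapping.lookup (Poly_Mapping.single i n))"
        using f by (auto simp: cover_prime_def monomial_span_def)
      then show False by (auto simp: off_degree_pos_iff lookup_single when_def split: if_splits)
    qed
    then show "\<forall>n. Poly_Mapping.lookup f (Poly_Mapping.single i n) = 0"
      by (simp add: in_keys_iff)
  next
    assume *: "\<forall>n. Poly_Mapping.lookup f (Poly_Mapping.single i n) = 0"
    have "0 < off_degree i (Poly_Mapping.lookup t)" if t: "t \<in> Poly_Mapping.keys f" for t
    proof (rule ccontr)
      assume "\<not> 0 < off_degree i (Poly_Mapping.lookup t)"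
      then have "t = Poly_Mapping.single i (Poly_Mapping.lookup t i)"
        unfolding off_degree_pos_iff
        by (intro poly_mapping_eqI) (auto simp: lookup_single when_def)
      then show False using * t by (metis in_keys_iff)
    qed
    then show "f \<in> cover_prime i" by (auto simp: cover_prime_def monomial_span_def Suc_le_eq)
  qed
  then show ?thesis
    by (auto simp: poly_mapping_eq_iff map_key.rep_eq[OF inj_single] fun_eq_iff)
qed

text \<open>The kernel of the substitution of zero for the variables other than \<open>x\<^sub>i\<close> is prime, since its
  target, the univariate polynomials \<open>nat \<Rightarrow>\<^sub>0 'k\<close>, is an integral domain.\<close>

lemma primeideal_cover_prime:
  "primeideal (cover_prime i :: ('n::finite, 'k::field) mpoly set) mpoly_ring"
proof (rule primeidealI)
  show "ideal (cover_prime i :: ('n, 'k) mpoly set) mpoly_ring"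
    unfolding cover_prime_def by (rule ideal_monomial_span[OF up_closed_off_degree])
  have "(1 :: ('n, 'k) mpoly) \<notin> cover_prime i"
    by (simp add: cover_prime_def monomial_span_def off_degree_def)
  then show "carrier mpoly_ring \<noteq> (cover_prime i :: ('n, 'k) mpoly set)" by auto
qed (auto simp: cover_prime_eq_kernel map_key_single_mult cring_mpoly_ring)

lemma cover_prime_subset_iff:
  "(cover_prime i :: ('n::finite, 'k::field) mpoly set) \<subseteq> cover_prime j \<longleftrightarrow> i = j"
proof
  let ?x = "monomial (\<lambda>k. if k = j then 1 else 0) :: ('n, 'k) mpoly"
  assume "(cover_prime i :: ('n, 'k) mpoly set) \<subseteq> cover_prime j"
  moreover have "?x \<notin> cover_prime j" by (simp add: cover_prime_def off_degree_unit)
  ultimately have "?x \<notin> cover_prime i" by blast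
  then show "i = j" by (simp add: cover_prime_def off_degree_unit split: if_splits)
qed simp

text \<open>In the induction step an exponent of off-degree at least \<open>s + 1\<close> is split by taking out one
  variable other than \<open>x\<^sub>i\<close>.\<close>

lemma cover_prime_power:
  "(cover_prime i :: ('n::finite, 'k::field) mpoly set) [^]\<^bsub>ideals_set mpoly_ring\<^esub> s =
   monomial_span {a. s \<le> off_degree i a}"
proof (induction s)
  case 0
  show ?case by (simp add: nat_pow_def ideals_set_def)
next
  case (Suc s)
  have "\<exists>a\<in>{a. s \<le> off_degree i a}. \<exists>b\<in>{a. 1 \<le> off_degree i a}. c = (\<lambda>j. a j + b j)"
    if c: "Suc s \<le> off_degree i c" for c
  proof -
    have "0 < off_degree i c" using c by simp
    then obtain j where j: "j \<noteq> i" "0 < c j" by (auto simp: off_degree_pos_iff)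
    let ?b = "\<lambda>k. if k = j then 1 else 0 :: nat"
    let ?a = "\<lambda>k. c k - ?b k"
    have split: "c = (\<lambda>k. ?a k + ?b k)" using j by auto
    have "off_degree i c = off_degree i ?a + 1"
      using j off_degree_add[of i ?a ?b] split by (simp add: off_degree_unit)
    then show ?thesis
      using c j split by (intro bexI[of _ ?a] bexI[of _ ?b]) (auto simp: off_degree_unit)
  qed
  then have eq: "{c. \<exists>a\<in>{a. s \<le> off_degree i a}. \<exists>b\<in>{a. 1 \<le> off_degree i a}. c = (\<lambda>j. a j + b j)} =
      {a. Suc s \<le> off_degree i a}"
    by (auto simp: off_degree_add)
  have "(cover_prime i :: ('n, 'k) mpoly set) [^]\<^bsub>ideals_set mpoly_ring\<^esub> Suc s =
      ideal_prod mpoly_ring (cover_prime i [^]\<^bsub>ideals_set mpoly_ring\<^esub> s) (cover_prime i)"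
    by (simp add: nat_pow_def ideals_set_def)
  also have "\<dots> = monomial_span {a. Suc s \<le> off_degree i a}"
    unfolding Suc.IH unfolding cover_prime_def ideal_prod_monomial_span eq ..
  finally show ?case .
qed

lemma var_eq_monomial: "var i = monomial (\<lambda>k. if k = i then 1 else 0)"
proof -
  have "Poly_Mapping.single i 1 = Abs_poly_mapping (\<lambda>k. if k = i then 1 else 0 :: nat)"
    by (rule poly_mapping_eqI) (simp add: lookup_single when_def)
  then show ?thesis by (simp add: var_def monomial_eq_single)
qed

text \<open>If some variable other than \<open>x\<^sub>i\<close> divides \<open>x\<^sup>c\<close> for every \<open>i\<close>, then two applications of this
  give two different variables dividing \<open>x\<^sup>c\<close>, hence an edge.\<close>

lemma edge_ideal_complete_graph:
  "(edge_ideal complete_graph :: ('n::finite, 'k::field) mpoly set) = (\<Inter>i. cover_prime i)"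
proof -
  define e :: "'n \<Rightarrow> 'n \<Rightarrow> nat" where "e = (\<lambda>i k. if k = i then 1 else 0)"
  define B where "B = {b. \<exists>i j. i \<noteq> j \<and> b = (\<lambda>k. e i k + e j k)}"
  have "{var i * var j | i j. {i, j} \<in> complete_graph} = (monomial ` B :: ('n, 'k) mpoly set)"
  proof -
    have "{i, j} \<in> complete_graph \<longleftrightarrow> i \<noteq> j" for i j :: 'n
      by (auto simp: complete_graph_def doubleton_eq_iff)
    then show ?thesis
      by (auto simp: var_eq_monomial monomial_mult B_def e_def)
  qed
  moreover have "up_closure B = (\<Inter>i. {a. 1 \<le> off_degree i a})"
  proof (intro equalityI subsetI)
    fix c assume "c \<in> up_closure B"
    then obtain i j where ij: "i \<noteq> j" "(\<lambda>k. e i k + e j k) \<le> c"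
      by (auto simp: up_closure_def B_def)
    have "0 < c k" if "k = i \<or> k = j" for k
      using that ij(1) le_funD[OF ij(2), of k] by (auto simp: e_def split: if_splits)
    then have "0 < off_degree l c" for l
      using ij(1) unfolding off_degree_pos_iff by metis
    then show "c \<in> (\<Inter>i. {a. 1 \<le> off_degree i a})" by (auto simp: Suc_le_eq)
  next
    fix c :: "'n \<Rightarrow> nat" assume "c \<in> (\<Inter>i. {a. 1 \<le> off_degree i a})"
    then have pos: "\<exists>j. j \<noteq> i \<and> 0 < c j" for i
      unfolding off_degree_pos_iff[symmetric] by (auto simp: Suc_le_eq)
    obtain j where j: "0 < c j" using pos by blast
    obtain k where k: "k \<noteq> j" "0 < c k" using pos by blast
    have "(\<lambda>l. e j l + e k l) \<le> c" using j k by (auto simp: le_fun_def e_def Suc_le_eq)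
    moreover have "(\<lambda>l. e j l + e k l) \<in> B"
      using k(1) unfolding B_def by (metis (mono_tags, lifting) mem_Collect_eq)
    ultimately show "c \<in> up_closure B" unfolding up_closure_def by blast
  qed
  ultimately show ?thesis
    by (simp add: edge_ideal_def genideal_monomials cover_prime_def monomial_span_INT)
qed

lemma symbolic_power_edge_ideal_complete_graph:
  "symbolic_power mpoly_ring (edge_ideal complete_graph :: ('n::finite, 'k::field) mpoly set) s =
   monomial_span (\<Inter>i. {a. s \<le> off_degree i a})"
proof -
  let ?P = "range cover_prime :: ('n, 'k) mpoly set set"
  have "symbolic_power mpoly_ring (edge_ideal complete_graph :: ('n, 'k) mpoly set) s =
      carrier mpoly_ring \<inter> (\<Inter>P\<in>?P. P [^]\<^bsub>ideals_set mpoly_ring\<^esub> s)"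
  proof (rule cring.symbolic_power_Inter_primes[OF cring_mpoly_ring])
    show "edge_ideal complete_graph = carrier mpoly_ring \<inter> \<Inter>?P"
      by (simp add: edge_ideal_complete_graph)
    show "P = Q" if "P \<in> ?P" "Q \<in> ?P" "P \<subseteq> Q" for P Q
      using that by (auto simp: cover_prime_subset_iff)
  qed (auto simp: primeideal_cover_prime)
  then show ?thesis by (simp add: cover_prime_power monomial_span_INT)
qed

section \<open>Minimal exponents\<close>

lemma off_degree_add_self: "off_degree i a + a i = (\<Sum>j\<in>UNIV. a j)"
  by (simp add: off_degree_def sum.remove[of UNIV i] add.commute)

lemma off_degree_decrease:
  assumes "0 < a l"
  shows "off_degree i (a(l := a l - 1)) = (if l = i then off_degree i a else off_degree i a - 1)"
proof (cases "l = i")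
  case False
  then show ?thesis
    using assms by (simp add: off_degree_def sum.remove[of "UNIV - {i}" l])
qed (simp add: off_degree_def)

text \<open>If \<open>a\<close> is minimal and \<open>i\<close> is the index of a maximal entry, lowering \<open>a i\<close> must break the
  condition at some \<open>j \<noteq> i\<close>, which is therefore tight: \<open>off_degree j a = s\<close>.  As the off-degree
  at \<open>i\<close> is at least \<open>s\<close>, this forces \<open>a j = a i\<close>.  Conversely the two tight indices \<open>i\<close>, \<open>j\<close>
  leave no room for lowering any entry.  The assumption \<open>0 < s\<close> excludes the value
  \<open>Max {}\<close>, which would occur for a single variable.\<close>

lemma minimal_elements_symbolic_power:
  fixes s :: nat
  assumes "0 < s"
  shows "minimal_elements (\<Inter>i. {a :: 'n::finite \<Rightarrow> nat. s \<le> off_degree i a}) =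
    {a. \<exists>i. off_degree i a = s \<and> a i = Max (a ` (UNIV - {i}))}" (is "minimal_elements ?A = ?M")
proof (intro equalityI subsetI)
  fix a assume a: "a \<in> minimal_elements ?A"
  then have ge: "s \<le> off_degree i a" for i by (auto simp: minimal_elements_def)
  have "Max (range a) \<in> range a" by (intro Max_in) auto
  then obtain i where "a i = Max (range a)" by (metis imageE)
  then have i: "a j \<le> a i" for j by simp
  \<comment> \<open>Some entry other than \<open>a i\<close> is positive because \<open>s\<close> is.\<close>
  have pos: "0 < a i"
  proof -
    have "0 < off_degree i a" using ge[of i] assms by simp
    then show ?thesis using i unfolding off_degree_pos_iff by (metis gr_zeroI leD)
  qed
  have "a(i := a i - 1) \<noteq> a" using pos by (metis diff_less fun_upd_same less_numeral_extra(1) nat_neq_iff)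
  moreover have "a(i := a i - 1) \<le> a" by (simp add: le_fun_def)
  ultimately have "a(i := a i - 1) \<notin> ?A" using a by (auto simp: minimal_elements_def)
  then obtain j where "off_degree j (a(i := a i - 1)) < s" by (auto simp: not_le)
  then have j: "j \<noteq> i" "off_degree j a = s"
    using ge[of j] off_degree_decrease[of a i j, OF pos] by (auto split: if_splits)
  have "a i \<le> a j"
    using off_degree_add_self[of i a] off_degree_add_self[of j a] ge[of i] j(2) by linarith
  then have eq: "a i = a j" using i[of j] by simp
  have "Max (a ` (UNIV - {j})) = a i"
    using i j(1) by (intro Max_eqI) auto
  then show "a \<in> ?M" using j(2) eq by auto
next
  fix a assume "a \<in> ?M"
  then obtain i where i: "off_degree i a = s" "a i = Max (a ` (UNIV - {i}))" by auto
  have ne: "UNIV - {i} \<noteq> {}" using i(1) assms off_degree_pos_iff[of i a] by blast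
  have "a i \<in> a ` (UNIV - {i})" unfolding i(2) using ne by (intro Max_in) auto
  then obtain j where j: "j \<noteq> i" "a j = a i" by (metis DiffE imageE singletonI)
  have max: "a k \<le> a i" for k
  proof (cases "k = i")
    case False
    then have "a k \<le> Max (a ` (UNIV - {i}))" by (intro Max_ge) auto
    then show ?thesis using i(2) by simp
  qed simp
  have "s \<le> off_degree k a" for k
    using off_degree_add_self[of i a] off_degree_add_self[of k a] i(1) max[of k] by linarith
  moreover have "b = a" if b: "b \<in> ?A" "b \<le> a" for b
  proof (rule ccontr)
    assume "b \<noteq> a"
    then obtain l where "b l \<noteq> a l" by auto
    with b(2) have l: "b l < a l" by (metis le_fun_def order_le_less)
    have "off_degree j a = s"
      using off_degree_add_self[of i a] off_degree_add_self[of j a] i(1) j(2) by linarith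
    \<comment> \<open>One of the tight indices \<open>i\<close>, \<open>j\<close> differs from \<open>l\<close>, so its off-degree counts entry \<open>l\<close>.\<close>
    then obtain k where k: "k \<noteq> l" "off_degree k a = s" using i(1) j(1) by metis
    have "off_degree k b < off_degree k a"
      unfolding off_degree_def using k(1) l b(2)
      by (intro sum_strict_mono_ex1) (auto simp: le_fun_def)
    moreover have "s \<le> off_degree k b" using b(1) by auto
    ultimately show False using k(2) by simp
  qed
  ultimately show "a \<in> minimal_elements ?A" by (auto simp: minimal_elements_def)
qed

theorem proposition3p2:
  fixes s :: nat
  assumes "s \<ge> 2"
  shows "minimal_monomial_generators
           (symbolic_power mpoly_ring
              (edge_ideal (complete_graph :: 'n::finite set set) :: ('n, 'k::field) mpoly set) s) =
         {monomial a | a. \<exists>i. (\<Sum>j\<in>UNIV - {i}. a j) = s \<and> a i = Max (a ` (UNIV - {i}))}"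
proof -
  let ?A = "\<Inter>i. {a :: 'n \<Rightarrow> nat. s \<le> off_degree i a}"
  have "up_closed ?A" using up_closed_off_degree unfolding up_closed_def by blast
  then have "minimal_monomial_generators (symbolic_power mpoly_ring
      (edge_ideal complete_graph :: ('n, 'k) mpoly set) s) = monomial ` minimal_elements ?A"
    unfolding symbolic_power_edge_ideal_complete_graph
    by (rule minimal_monomial_generators_monomial_span)
  also have "minimal_elements ?A =
      {a. \<exists>i. off_degree i a = s \<and> a i = Max (a ` (UNIV - {i}))}"
    using assms by (intro minimal_elements_symbolic_power) simp
  finally show ?thesis unfolding off_degree_def by blast
qed

end
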